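(* Let $H$ be a commutative ring with identity, $S$ a multiplicatively closed subset of $H$, and $A$ a prime ideal of $H$ with $A\cap S=\varnothing$. Then $A$ is an $S$-$r$-ideal of $H$ if and only if $A\subseteq \mathrm{zd}(H)$.
   Context: For $w\in H$, $\mathrm{Ann}(w)=\{y\in H: yw=0\}$; $\mathrm{zd}(H)=\{w\in H:\mathrm{Ann}(w)\neq 0\}$ is the set of zero divisors of $H$. A multiplicatively closed subset $S$ of $H$ is a subset containing $1$ and closed under products. An ideal $A$ of $H$ is an $S$-$r$-ideal if $A\cap S=\varnothing$ and there exists $s\in S$ such that for all $w,z\in H$, if $wz\in A$ and $\mathrm{Ann}(w)=0$, then $sz\in A$. *)

theory Defs
  imports "HOL-Algebra.Ideal"
begin

definition Ann :: "('a, 'b) ring_scheme \<Rightarrow> 'a \<Rightarrow> 'a set" where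
  "Ann H w = {y \<in> carrier H. y \<otimes>\<^bsub>H\<^esub> w = \<zero>\<^bsub>H\<^esub>}"

text \<open>By this convention, the zero element of a nonzero ring is a zero divisor.\<close>

definition zd :: "('a, 'b) ring_scheme \<Rightarrow> 'a set" where
  "zd H = {w \<in> carrier H. Ann H w \<noteq> {\<zero>\<^bsub>H\<^esub>}}"

text \<open>A multiplicatively closed subset of \<open>H\<close> is a \<^const>\<open>submonoid\<close> of the
  multiplicative monoid of \<open>H\<close>; it may contain zero.\<close>

definition S_r_ideal :: "('a, 'b) ring_scheme \<Rightarrow> 'a set \<Rightarrow> 'a set \<Rightarrow> bool" where
  "S_r_ideal H S A \<longleftrightarrow>
     ideal A H \<and> A \<inter> S = {} \<and>
     (\<exists>s\<in>S. \<forall>w\<in>carrier H. \<forall>z\<in>carrier H.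
        w \<otimes>\<^bsub>H\<^esub> z \<in> A \<and> Ann H w = {\<zero>\<^bsub>H\<^esub>} \<longrightarrow> s \<otimes>\<^bsub>H\<^esub> z \<in> A)"

end

theory Submission
  imports Defs
begin

text \<open>Both directions rest on substituting the identity. If a regular element \<open>w\<close> lay in \<open>A\<close>, the
  \<open>S\<close>-\<open>r\<close>-property for \<open>w \<cdot> 1 \<in> A\<close> would put its witness \<open>s \<in> S\<close> into \<open>A\<close>, which is
  disjoint from \<open>S\<close>. Conversely, if \<open>A\<close> contains no regular element, primality lets every regular
  factor of an element of \<open>A\<close> be cancelled, so \<open>1 \<in> S\<close> is a witness.\<close>

theorem theorem2p3:
  fixes H :: "('a, 'b) ring_scheme" and S A :: "'a set"
  assumes "cring H"
    and "submonoid S H"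
    and "primeideal A H"
    and "A \<inter> S = {}"
  shows "S_r_ideal H S A \<longleftrightarrow> A \<subseteq> zd H"
proof -
  interpret cring H by fact
  interpret S: submonoid S H by fact
  interpret A: primeideal A H by fact
  show ?thesis
  proof
    assume "S_r_ideal H S A"
    then obtain s where s: "s \<in> S"
      and cancel: "\<And>w z. \<lbrakk>w \<in> carrier H; z \<in> carrier H; w \<otimes>\<^bsub>H\<^esub> z \<in> A; Ann H w = {\<zero>\<^bsub>H\<^esub>}\<rbrakk>
        \<Longrightarrow> s \<otimes>\<^bsub>H\<^esub> z \<in> A"
      unfolding S_r_ideal_def by blast
    have s_carrier: "s \<in> carrier H"
      using s S.subset by blast
    show "A \<subseteq> zd H"
    proof
      fix w assume w: "w \<in> A"
      then have w_carrier: "w \<in> carrier H"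
        by (rule A.Icarr)
      have "Ann H w \<noteq> {\<zero>\<^bsub>H\<^esub>}"
      proof
        assume "Ann H w = {\<zero>\<^bsub>H\<^esub>}"
        then have "s \<otimes>\<^bsub>H\<^esub> \<one>\<^bsub>H\<^esub> \<in> A"
          using cancel[of w "\<one>\<^bsub>H\<^esub>"] w w_carrier by simp
        then have "s \<in> A \<inter> S"
          using s s_carrier by simp
        then show False
          using \<open>A \<inter> S = {}\<close> by blast
      qed
      then show "w \<in> zd H"
        using w_carrier by (simp add: zd_def)
    qed
  next
    assume zd: "A \<subseteq> zd H"
    have "\<one>\<^bsub>H\<^esub> \<otimes>\<^bsub>H\<^esub> z \<in> A"
      if "w \<in> carrier H" "z \<in> carrier H" "w \<otimes>\<^bsub>H\<^esub> z \<in> A" "Ann H w = {\<zero>\<^bsub>H\<^esub>}" for w z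
    proof -
      have "w \<notin> A"
        using zd that(4) by (auto simp: zd_def)
      then show ?thesis
        using A.I_prime[of w z] that by auto
    qed
    then show "S_r_ideal H S A"
      unfolding S_r_ideal_def
      using A.is_ideal \<open>A \<inter> S = {}\<close> S.one_closed by blast
  qed
qed

end
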